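(* Let $\beta\in\mathbb R$, $\gamma>0$, and let $\mathbf U^0,\mathbf U^1,\dots,\mathbf U^M\in\mathbb V_h$ satisfy the scheme $$\mathrm i\delta_t\mathbf U^n+\mathbf\Delta_h\widehat{\mathbf U}^n+\beta e^{-2\gamma t_n}|\mathbf U^n|^2\cdot\widehat{\mathbf U}^n=0,\quad n=1,\dots,M-1.$$ Then the scheme possesses the discrete total energy conservation law $$\mathcal E^n=\mathcal E^0,\quad n=1,\dots,M-1,$$ where $$\mathcal E^n=\frac12|\mathbf U^{n+1}|_h^2+\frac12|\mathbf U^n|_h^2-\frac\beta2e^{-2\gamma t_n}h_\Delta\sum_{\vec j\in J_h}|U^n_{\vec j}|^2|U^{n+1}_{\vec j}|^2-\frac\beta2\sum_{l=1}^ne^{-2\gamma t_{l-1}}(1-e^{-2\gamma\tau})h_\Delta\sum_{\vec j\in J_h}|U^{l-1}_{\vec j}|^2|U^l_{\vec j}|^2.$$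
   Context: Grid: $\Omega=[0,l_1]\times[0,l_2]\times[0,l_3]$; $N_1,N_2,N_3$ are even positive integers, $h_r=l_r/N_r$, $J_h=\{\vec j=(j_1,j_2,j_3):0\le j_r\le N_r-1,\ r=1,2,3\}$. $\mathbb V_h$ is the space of complex grid functions $\mathbf U=(U_{\vec j})_{\vec j\in J_h}$, extended periodically with period $N_r$ in the index $j_r$. With $h_\Delta=h_1h_2h_3$: $\langle\mathbf U,\mathbf V\rangle_h=h_\Delta\sum_{\vec j\in J_h}U_{\vec j}\overline{V_{\vec j}}$. The dot $\cdot$ between grid functions is the componentwise product and $|\mathbf U|^2=\mathbf U\cdot\bar{\mathbf U}$. Fourier pseudo-spectral Laplacian: for $r=1,2,3$ let $\mu_r=2\pi/l_r$, let $w^{(r)}_j=jh_r$, let $g^{(r)}_j(w)=\frac1{N_r}\sum_{l=-N_r/2}^{N_r/2}\frac1{a_l}e^{\mathrm il\mu_r(w-w^{(r)}_j)}$ with $a_l=1$ for $|l|<N_r/2$ and $a_l=2$ for $|l|=N_r/2$, and let $\mathbf D^{(r)}$ be the real symmetric $N_r\times N_r$ matrix with entries $(\mathbf D^{(r)})_{k,j}=\frac{d^2g^{(r)}_j}{dw^2}(w^{(r)}_k)$, $0\le k,j\le N_r-1$. Then $$(\mathbf\Delta_h\mathbf U)_{\vec j}=\sum_{j=0}^{N_1-1}(\mathbf D^{(1)})_{j_1,j}U_{j,j_2,j_3}+\sum_{k=0}^{N_2-1}(\mathbf D^{(2)})_{j_2,k}U_{j_1,k,j_3}+\sum_{m=0}^{N_3-1}(\mathbf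 D^{(3)})_{j_3,m}U_{j_1,j_2,m}.$$ The induced semi-norm is $|\mathbf U|_h^2=\langle-\mathbf\Delta_h\mathbf U,\mathbf U\rangle_h$. Time discretization: $T>0$, $M$ a positive integer, $\tau=T/M$, $t_n=n\tau$; $\delta_t\mathbf U^n=\frac{\mathbf U^{n+1}-\mathbf U^{n-1}}{2\tau}$, $\widehat{\mathbf U}^n=\frac{\mathbf U^{n+1}+\mathbf U^{n-1}}2$. *)

theory Defs
  imports "HOL-Analysis.Analysis"
begin

text \<open>
  The side lengths \<open>L\<close> and the numbers of grid points \<open>N\<close> are families indexed by the
  direction \<open>r \<in> {1, 2, 3}\<close>. Grid functions live on the whole integer lattice; the space
  of grid functions consists of the periodic ones.
\<close>

type_synonym grid_fun = "int \<times> int \<times> int \<Rightarrow> complex"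

definition mesh :: "(nat \<Rightarrow> real) \<Rightarrow> (nat \<Rightarrow> nat) \<Rightarrow> nat \<Rightarrow> real" where
  "mesh L N r = L r / real (N r)"

definition cell_volume :: "(nat \<Rightarrow> real) \<Rightarrow> (nat \<Rightarrow> nat) \<Rightarrow> real" where
  "cell_volume L N = mesh L N 1 * mesh L N 2 * mesh L N 3"

definition grid_indices :: "(nat \<Rightarrow> nat) \<Rightarrow> (int \<times> int \<times> int) set" where
  "grid_indices N = {0..<int (N 1)} \<times> {0..<int (N 2)} \<times> {0..<int (N 3)}"

definition grid_space :: "(nat \<Rightarrow> nat) \<Rightarrow> grid_fun set" where
  "grid_space N = {U. \<forall>j1 j2 j3.
     U (j1 + int (N 1), j2, j3) = U (j1, j2, j3) \<and>
     U (j1, j2 + int (N 2), j3) = U (j1, j2, j3) \<and>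
     U (j1, j2, j3 + int (N 3)) = U (j1, j2, j3)}"

definition grid_inner :: "(nat \<Rightarrow> real) \<Rightarrow> (nat \<Rightarrow> nat) \<Rightarrow> grid_fun \<Rightarrow> grid_fun \<Rightarrow> complex" where
  "grid_inner L N U V =
     of_real (cell_volume L N) * (\<Sum>j\<in>grid_indices N. U j * cnj (V j))"

definition end_weight :: "nat \<Rightarrow> int \<Rightarrow> real" where
  "end_weight n k = (if \<bar>k\<bar> = int n div 2 then 2 else 1)"

definition interp_basis :: "(nat \<Rightarrow> real) \<Rightarrow> (nat \<Rightarrow> nat) \<Rightarrow> nat \<Rightarrow> int \<Rightarrow> real \<Rightarrow> complex" where
  "interp_basis L N r j w =
     1 / of_nat (N r) *
     (\<Sum>k = - (int (N r) div 2)..int (N r) div 2.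
        1 / of_real (end_weight (N r) k) *
        exp (\<i> * of_real (of_int k * (2 * pi / L r) * (w - of_int j * mesh L N r))))"

text \<open>The trigonometric basis functions map reals to complex numbers, so the entries of
  the differentiation matrix are complex numbers here, although they have no imaginary part.\<close>

definition diff_matrix :: "(nat \<Rightarrow> real) \<Rightarrow> (nat \<Rightarrow> nat) \<Rightarrow> nat \<Rightarrow> int \<Rightarrow> int \<Rightarrow> complex" where
  "diff_matrix L N r k j =
     vector_derivative (\<lambda>w. vector_derivative (interp_basis L N r j) (at w))
       (at (of_int k * mesh L N r))"

definition discrete_laplacian :: "(nat \<Rightarrow> real) \<Rightarrow> (nat \<Rightarrow> nat) \<Rightarrow> grid_fun \<Rightarrow> grid_fun" where
  "discrete_laplacian L N U = (\<lambda>(j1, j2, j3).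
     (\<Sum>j\<in>{0..<int (N 1)}. diff_matrix L N 1 j1 j * U (j, j2, j3)) +
     (\<Sum>k\<in>{0..<int (N 2)}. diff_matrix L N 2 j2 k * U (j1, k, j3)) +
     (\<Sum>m\<in>{0..<int (N 3)}. diff_matrix L N 3 j3 m * U (j1, j2, m)))"

text \<open>The inner product below is a nonnegative real number, hence the square of this
  semi-norm is the inner product itself; see \<open>grid_seminorm_square\<close>.\<close>

definition grid_seminorm :: "(nat \<Rightarrow> real) \<Rightarrow> (nat \<Rightarrow> nat) \<Rightarrow> grid_fun \<Rightarrow> real" where
  "grid_seminorm L N U = sqrt (Re (grid_inner L N (\<lambda>j. - discrete_laplacian L N U j) U))"

definition central_diff :: "real \<Rightarrow> (nat \<Rightarrow> grid_fun) \<Rightarrow> nat \<Rightarrow> grid_fun" where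
  "central_diff \<tau> U n = (\<lambda>j. (U (n + 1) j - U (n - 1) j) / (2 * of_real \<tau>))"

definition time_average :: "(nat \<Rightarrow> grid_fun) \<Rightarrow> nat \<Rightarrow> grid_fun" where
  "time_average U n = (\<lambda>j. (U (n + 1) j + U (n - 1) j) / 2)"

definition scheme :: "(nat \<Rightarrow> real) \<Rightarrow> (nat \<Rightarrow> nat) \<Rightarrow> real \<Rightarrow> real \<Rightarrow> real \<Rightarrow> nat \<Rightarrow>
    (nat \<Rightarrow> grid_fun) \<Rightarrow> bool" where
  "scheme L N \<beta> \<gamma> \<tau> M U \<longleftrightarrow>
     (\<forall>n\<in>{1..M - 1}. \<forall>j\<in>grid_indices N.
        \<i> * central_diff \<tau> U n j + discrete_laplacian L N (time_average U n) j
        + of_real (\<beta> * exp (- 2 * \<gamma> * (real n * \<tau>))) * (U n j * cnj (U n j))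
            * time_average U n j = 0)"

definition total_energy :: "(nat \<Rightarrow> real) \<Rightarrow> (nat \<Rightarrow> nat) \<Rightarrow> real \<Rightarrow> real \<Rightarrow> real \<Rightarrow>
    (nat \<Rightarrow> grid_fun) \<Rightarrow> nat \<Rightarrow> real" where
  "total_energy L N \<beta> \<gamma> \<tau> U n =
     1 / 2 * (grid_seminorm L N (U (n + 1)))\<^sup>2 + 1 / 2 * (grid_seminorm L N (U n))\<^sup>2
     - \<beta> / 2 * exp (- 2 * \<gamma> * (real n * \<tau>)) * cell_volume L N
         * (\<Sum>j\<in>grid_indices N. (cmod (U n j))\<^sup>2 * (cmod (U (n + 1) j))\<^sup>2)
     - \<beta> / 2 * (\<Sum>l = 1..n.
         exp (- 2 * \<gamma> * (real (l - 1) * \<tau>)) * (1 - exp (- 2 * \<gamma> * \<tau>)) * cell_volume L N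
         * (\<Sum>j\<in>grid_indices N. (cmod (U (l - 1) j))\<^sup>2 * (cmod (U l j))\<^sup>2))"

lemma has_vector_derivative_exp_freq:
  "((\<lambda>w. exp (\<i> * of_real (a * (w - b)))) has_vector_derivative
      (\<i> * of_real a) * exp (\<i> * of_real (a * (w - b)))) (at w)"
proof -
  have "((\<lambda>z. exp (\<i> * (of_real a * (z - of_real b)))) has_field_derivative
      (\<i> * of_real a) * exp (\<i> * (of_real a * (of_real w - of_real b)))) (at (of_real w))"
    by (auto intro!: derivative_eq_intros)
  from has_vector_derivative_real_field[OF this] show ?thesis
    by simp
qed

lemma diff_matrix_eq:
  "diff_matrix L N r k j =
     - (1 / of_nat (N r)) *
     (\<Sum>m = - (int (N r) div 2)..int (N r) div 2.
        of_real ((of_int m * (2 * pi / L r))\<^sup>2 / end_weight (N r) m) *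
        (exp (\<i> * of_real (of_int m * (2 * pi / L r) * (of_int k * mesh L N r))) *
         cnj (exp (\<i> * of_real (of_int m * (2 * pi / L r) * (of_int j * mesh L N r))))))"
proof -
  define I where "I = {- (int (N r) div 2)..int (N r) div 2}"
  define a where "a m = of_int m * (2 * pi / L r)" for m :: int
  define c where "c m = 1 / complex_of_real (end_weight (N r) m)" for m
  define b where "b = of_int j * mesh L N r"
  have g: "interp_basis L N r j = (\<lambda>w. 1 / of_nat (N r) *
      (\<Sum>m\<in>I. c m * exp (\<i> * of_real (a m * (w - b)))))"
    by (simp add: fun_eq_iff interp_basis_def I_def a_def c_def b_def)
  have d1: "vector_derivative (interp_basis L N r j) (at w) = 1 / of_nat (N r) *
      (\<Sum>m\<in>I. c m * ((\<i> * of_real (a m)) * exp (\<i> * of_real (a m * (w - b)))))" for w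
    unfolding g
    by (intro vector_derivative_at has_vector_derivative_mult_right
        has_vector_derivative_sum has_vector_derivative_exp_freq)
  have d2: "diff_matrix L N r k j = 1 / of_nat (N r) *
      (\<Sum>m\<in>I. c m * ((\<i> * of_real (a m)) * ((\<i> * of_real (a m)) *
         exp (\<i> * of_real (a m * (of_int k * mesh L N r - b))))))"
    unfolding diff_matrix_def d1
    by (intro vector_derivative_at has_vector_derivative_mult_right
        has_vector_derivative_sum has_vector_derivative_exp_freq)
  have e: "exp (\<i> * of_real (x * (y - b))) =
      exp (\<i> * of_real (x * y)) * cnj (exp (\<i> * of_real (x * b)))" for x y
    by (simp add: exp_cnj right_diff_distrib flip: exp_add)
  have s: "c m * ((\<i> * of_real (a m)) * ((\<i> * of_real (a m)) * X)) =
      - (of_real ((a m)\<^sup>2 / end_weight (N r) m) * X)" for m X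
    by (simp add: c_def power2_eq_square field_simps)
  show ?thesis
    unfolding d2 e s sum_negf by (simp add: I_def a_def b_def)
qed

lemma diff_matrix_form_nonneg:
  assumes "finite A"
  shows "(\<Sum>k\<in>A. \<Sum>j\<in>A. - diff_matrix L N r k j * u j * cnj (u k)) \<in> \<real>\<^sub>\<ge>\<^sub>0"
proof -
  define I where "I = {- (int (N r) div 2)..int (N r) div 2}"
  define q where "q m = 1 / real (N r) * ((of_int m * (2 * pi / L r))\<^sup>2 / end_weight (N r) m)" for m
  define e where "e m k = exp (\<i> * of_real (of_int m * (2 * pi / L r) * (of_int k * mesh L N r)))"
    for m k :: int
  have D: "- diff_matrix L N r k j = (\<Sum>m\<in>I. of_real (q m) * (e m k * cnj (e m j)))" for k j
    unfolding diff_matrix_eq by (simp add: I_def q_def e_def sum_distrib_left sum_negf mult.assoc)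
  have "(\<Sum>k\<in>A. \<Sum>j\<in>A. - diff_matrix L N r k j * u j * cnj (u k)) =
      (\<Sum>k\<in>A. \<Sum>j\<in>A. \<Sum>m\<in>I. of_real (q m) * (cnj (e m j) * u j) * (cnj (cnj (e m k) * u k)))"
    unfolding D by (simp add: sum_distrib_left sum_distrib_right mult_ac)
  also have "\<dots> = (\<Sum>k\<in>A. \<Sum>m\<in>I. \<Sum>j\<in>A.
      of_real (q m) * (cnj (e m j) * u j) * (cnj (cnj (e m k) * u k)))"
    by (intro sum.cong refl sum.swap)
  also have "\<dots> = (\<Sum>m\<in>I. \<Sum>k\<in>A. \<Sum>j\<in>A.
      of_real (q m) * (cnj (e m j) * u j) * (cnj (cnj (e m k) * u k)))"
    by (rule sum.swap)
  also have "\<dots> = (\<Sum>m\<in>I. of_real (q m) *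
      ((\<Sum>j\<in>A. cnj (e m j) * u j) * cnj (\<Sum>j\<in>A. cnj (e m j) * u j)))"
    by (intro sum.cong refl) (simp add: sum_product sum_distrib_left mult_ac)
  also have "\<dots> = of_real (\<Sum>m\<in>I. q m * (cmod (\<Sum>j\<in>A. cnj (e m j) * u j))\<^sup>2)"
    by (simp only: of_real_sum of_real_mult complex_norm_square)
  also have "\<dots> \<in> \<real>\<^sub>\<ge>\<^sub>0"
    unfolding nonneg_Reals_of_real_iff
    by (intro sum_nonneg mult_nonneg_nonneg) (auto simp: q_def end_weight_def)
  finally show ?thesis .
qed

lemma nonneg_Reals_sum:
  assumes "\<And>x. x \<in> A \<Longrightarrow> f x \<in> \<real>\<^sub>\<ge>\<^sub>0"
  shows "sum f A \<in> \<real>\<^sub>\<ge>\<^sub>0"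
  using assms by (induction A rule: infinite_finite_induct) auto

lemma grid_seminorm_square:
  assumes "\<forall>r\<in>{1, 2, 3}. 0 < L r"
  shows "of_real ((grid_seminorm L N U)\<^sup>2) =
    grid_inner L N (\<lambda>j. - discrete_laplacian L N U j) U"
proof -
  let ?A = "\<lambda>r. {0..<int (N r)}"
  have split: "(\<Sum>j\<in>grid_indices N. f j) =
      (\<Sum>j1\<in>?A 1. \<Sum>j2\<in>?A 2. \<Sum>j3\<in>?A 3. f (j1, j2, j3))" for f :: grid_fun
    by (simp add: grid_indices_def sum.cartesian_product case_prod_unfold)
  let ?T1 = "\<Sum>j2\<in>?A 2. \<Sum>j3\<in>?A 3. \<Sum>j1\<in>?A 1. \<Sum>j\<in>?A 1.
    - diff_matrix L N 1 j1 j * U (j, j2, j3) * cnj (U (j1, j2, j3))"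
  let ?T2 = "\<Sum>j1\<in>?A 1. \<Sum>j3\<in>?A 3. \<Sum>j2\<in>?A 2. \<Sum>k\<in>?A 2.
    - diff_matrix L N 2 j2 k * U (j1, k, j3) * cnj (U (j1, j2, j3))"
  let ?T3 = "\<Sum>j1\<in>?A 1. \<Sum>j2\<in>?A 2. \<Sum>j3\<in>?A 3. \<Sum>m\<in>?A 3.
    - diff_matrix L N 3 j3 m * U (j1, j2, m) * cnj (U (j1, j2, j3))"
  have T1: "?T1 = (\<Sum>j1\<in>?A 1. \<Sum>j2\<in>?A 2. \<Sum>j3\<in>?A 3. \<Sum>j\<in>?A 1.
    - diff_matrix L N 1 j1 j * U (j, j2, j3) * cnj (U (j1, j2, j3)))"
    by (subst (2) sum.swap, subst sum.swap) (rule refl)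
  have T2: "?T2 = (\<Sum>j1\<in>?A 1. \<Sum>j2\<in>?A 2. \<Sum>j3\<in>?A 3. \<Sum>k\<in>?A 2.
    - diff_matrix L N 2 j2 k * U (j1, k, j3) * cnj (U (j1, j2, j3)))"
    by (intro sum.cong refl sum.swap)
  have "(\<Sum>j\<in>grid_indices N. - discrete_laplacian L N U j * cnj (U j)) = ?T1 + ?T2 + ?T3"
    unfolding T1 T2 split discrete_laplacian_def prod.case sum.distrib[symmetric]
    by (intro sum.cong refl) (simp add: sum_distrib_left sum_distrib_right sum_negf algebra_simps)
  also have "\<dots> \<in> \<real>\<^sub>\<ge>\<^sub>0"
    by (intro nonneg_Reals_add_I nonneg_Reals_sum diff_matrix_form_nonneg) auto
  finally have S: "(\<Sum>j\<in>grid_indices N. - discrete_laplacian L N U j * cnj (U j)) \<in> \<real>\<^sub>\<ge>\<^sub>0" .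
  have "of_real (cell_volume L N) \<in> (\<real>\<^sub>\<ge>\<^sub>0 :: complex set)"
    using assms by (auto simp: cell_volume_def mesh_def)
  then have "grid_inner L N (\<lambda>j. - discrete_laplacian L N U j) U \<in> \<real>\<^sub>\<ge>\<^sub>0"
    unfolding grid_inner_def using S by (rule nonneg_Reals_mult_I)
  then show ?thesis
    by (auto simp: grid_seminorm_def elim!: nonneg_Reals_cases simp flip: of_real_power)
qed

end

theory Submission
  imports Defs
begin

text \<open>
  Pairing the scheme at time level \<open>n\<close> with \<open>U\<^sup>n\<^sup>+\<^sup>1 - U\<^sup>n\<^sup>-\<^sup>1\<close> and taking real parts turns it
  into an energy balance. The time difference contributes \<open>\<i>\<close> times a real number and
  disappears. The discrete Laplacian is symmetric, so that its mixed terms cancel and half the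
  difference of the squared semi-norms of \<open>U\<^sup>n\<^sup>-\<^sup>1\<close> and \<open>U\<^sup>n\<^sup>+\<^sup>1\<close> remains. In the nonlinear term,
  \<open>Re ((a + b) * cnj (a - b)) = \<bar>a\<bar>\<^sup>2 - \<bar>b\<bar>\<^sup>2\<close> leaves the quartic coupling of level \<open>n\<close> with
  \<open>n + 1\<close> minus the coupling of \<open>n - 1\<close> with \<open>n\<close>, both with the same factor
  \<open>exp (- 2 \<gamma> t\<^sub>n)\<close>. This balance is \<open>scheme_energy_balance\<close>.

  In the energy the coupling of \<open>n - 1\<close> with \<open>n\<close> appears with the older factor
  \<open>exp (- 2 \<gamma> t\<^sub>n\<^sub>-\<^sub>1)\<close>. The last summand of the memory sum, with
  \<open>exp (- 2 \<gamma> t\<^sub>n\<^sub>-\<^sub>1) (1 - exp (- 2 \<gamma> \<tau>)) = exp (- 2 \<gamma> t\<^sub>n\<^sub>-\<^sub>1) - exp (- 2 \<gamma> t\<^sub>n)\<close>, makes up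
  exactly for the decay of this factor over one step, and so the energies at levels \<open>n\<close> and
  \<open>n - 1\<close> agree.

  Symmetry of the Laplacian needs no computation with the differentiation matrices: by
  \<open>grid_seminorm_square\<close> its quadratic form is real on all complex grid functions, and over
  the complex numbers this forces a sesquilinear form to be Hermitian.
\<close>

lemma discrete_laplacian_lincomb:
  "discrete_laplacian L N (\<lambda>j. a * U j + b * V j) =
     (\<lambda>j. a * discrete_laplacian L N U j + b * discrete_laplacian L N V j)"
  by (simp add: discrete_laplacian_def fun_eq_iff sum.distrib sum_distrib_left
      algebra_simps)

lemma grid_inner_lincomb_left:
  "grid_inner L N (\<lambda>j. a * U j + b * V j) W = a * grid_inner L N U W + b * grid_inner L N V W"
  by (simp add: grid_inner_def sum.distrib sum_distrib_left algebra_simps)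

lemma grid_inner_lincomb_right:
  "grid_inner L N W (\<lambda>j. a * U j + b * V j) =
     cnj a * grid_inner L N W U + cnj b * grid_inner L N W V"
  by (simp add: grid_inner_def sum.distrib sum_distrib_left algebra_simps)

lemma laplacian_form_eq_seminorm:
  assumes "\<forall>r\<in>{1, 2, 3}. 0 < L r"
  shows "grid_inner L N (discrete_laplacian L N U) U = - of_real ((grid_seminorm L N U)\<^sup>2)"
  unfolding grid_seminorm_square[OF assms]
  by (simp add: grid_inner_def sum_negf)

text \<open>The mixed terms of the quadratic form at \<open>U + \<i> V\<close> are \<open>\<i>\<close> times the difference of the two
  sides below, before real parts are taken, and the quadratic form is real.\<close>

lemma Re_grid_inner_laplacian_commute:
  assumes "\<forall>r\<in>{1, 2, 3}. 0 < L r"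
  shows "Re (grid_inner L N (discrete_laplacian L N U) V) =
         Re (grid_inner L N (discrete_laplacian L N V) U)"
proof -
  let ?A = "discrete_laplacian L N" and ?W = "\<lambda>j. 1 * U j + \<i> * V j"
  have "Im (grid_inner L N (?A ?W) ?W) = 0" "Im (grid_inner L N (?A U) U) = 0"
    "Im (grid_inner L N (?A V) V) = 0"
    by (simp_all only: laplacian_form_eq_seminorm[OF assms] uminus_complex.sel Im_complex_of_real
        minus_zero)
  then show ?thesis
    unfolding discrete_laplacian_lincomb grid_inner_lincomb_left grid_inner_lincomb_right
    by (simp add: algebra_simps)
qed

lemma Re_laplacian_average_difference:
  assumes "\<forall>r\<in>{1, 2, 3}. 0 < L r"
  shows "Re (grid_inner L N (discrete_laplacian L N (\<lambda>j. (U j + V j) / 2)) (\<lambda>j. U j - V j)) =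
    ((grid_seminorm L N V)\<^sup>2 - (grid_seminorm L N U)\<^sup>2) / 2"
proof -
  let ?A = "discrete_laplacian L N"
  have "grid_inner L N (?A (\<lambda>j. (U j + V j) / 2)) (\<lambda>j. U j - V j) =
      grid_inner L N (?A (\<lambda>j. 1 / 2 * U j + 1 / 2 * V j)) (\<lambda>j. 1 * U j + (- 1) * V j)"
    by (simp add: add_divide_distrib)
  also have "\<dots> = (grid_inner L N (?A U) U - grid_inner L N (?A V) V
      + (grid_inner L N (?A V) U - grid_inner L N (?A U) V)) / 2"
    unfolding discrete_laplacian_lincomb grid_inner_lincomb_left grid_inner_lincomb_right
    by (simp add: field_simps)
  finally have expand: "grid_inner L N (?A (\<lambda>j. (U j + V j) / 2)) (\<lambda>j. U j - V j) = \<dots>" .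
  show ?thesis
    unfolding expand laplacian_form_eq_seminorm[OF assms]
    using Re_grid_inner_laplacian_commute[OF assms, of N U V]
    by (simp del: of_real_power)
qed

lemma Re_i_difference_quotient:
  "Re (\<i> * ((a - b) / (2 * of_real \<tau>)) * cnj (a - b)) = 0"
proof -
  have "\<i> * ((a - b) / (2 * of_real \<tau>)) * cnj (a - b) =
      \<i> * of_real ((cmod (a - b))\<^sup>2 / (2 * \<tau>))"
    by (simp only: complex_norm_square of_real_divide of_real_mult of_real_numeral
        times_divide_eq_right times_divide_eq_left mult.assoc)
  then show ?thesis by simp
qed

lemma Re_average_difference:
  "Re (of_real c * (u * cnj u) * ((a + b) / 2) * cnj (a - b)) =
     c / 2 * ((cmod u)\<^sup>2 * (cmod a)\<^sup>2 - (cmod b)\<^sup>2 * (cmod u)\<^sup>2)"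
proof -
  have difference: "Re ((a + b) / 2 * cnj (a - b)) = ((cmod a)\<^sup>2 - (cmod b)\<^sup>2) / 2"
    unfolding cmod_power2 by (simp add: power2_eq_square field_simps)
  have "of_real c * (u * cnj u) * ((a + b) / 2) * cnj (a - b) =
      of_real (c * (cmod u)\<^sup>2) * ((a + b) / 2 * cnj (a - b))"
    by (simp only: complex_norm_square of_real_mult mult.assoc)
  also have "Re \<dots> = c * (cmod u)\<^sup>2 * Re ((a + b) / 2 * cnj (a - b))"
    by (simp only: times_complex.sel Re_complex_of_real Im_complex_of_real mult_zero_left diff_zero)
  finally show ?thesis
    unfolding difference by (simp add: algebra_simps)
qed

text \<open>The real part of the scheme at level \<open>n\<close>, paired with \<open>U\<^sup>n\<^sup>+\<^sup>1 - U\<^sup>n\<^sup>-\<^sup>1\<close>.\<close>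

lemma scheme_energy_balance:
  assumes L: "\<forall>r\<in>{1, 2, 3}. 0 < L r" and scheme: "scheme L N \<beta> \<gamma> \<tau> M U"
    and n: "n \<in> {1..M - 1}"
  shows "(grid_seminorm L N (U (n + 1)))\<^sup>2 - (grid_seminorm L N (U (n - 1)))\<^sup>2 =
    \<beta> * exp (- 2 * \<gamma> * (real n * \<tau>)) * cell_volume L N *
      ((\<Sum>j\<in>grid_indices N. (cmod (U n j))\<^sup>2 * (cmod (U (n + 1) j))\<^sup>2) -
       (\<Sum>j\<in>grid_indices N. (cmod (U (n - 1) j))\<^sup>2 * (cmod (U n j))\<^sup>2))"
proof -
  let ?h = "cell_volume L N" and ?G = "grid_indices N"
  define c where "c = \<beta> * exp (- 2 * \<gamma> * (real n * \<tau>))"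
  define D where "D = (\<lambda>j. U (n + 1) j - U (n - 1) j)"
  define S where "S = (\<Sum>j\<in>?G. (cmod (U n j))\<^sup>2 * (cmod (U (n + 1) j))\<^sup>2)"
  define S' where "S' = (\<Sum>j\<in>?G. (cmod (U (n - 1) j))\<^sup>2 * (cmod (U n j))\<^sup>2)"
  define P where "P = c * ?h * (S - S')"
  have pointwise: "Re (discrete_laplacian L N (time_average U n) j * cnj (D j)) =
      - (c / 2 * ((cmod (U n j))\<^sup>2 * (cmod (U (n + 1) j))\<^sup>2
                  - (cmod (U (n - 1) j))\<^sup>2 * (cmod (U n j))\<^sup>2))" if "j \<in> ?G" for j
  proof -
    have "(\<i> * central_diff \<tau> U n j + discrete_laplacian L N (time_average U n) j
        + of_real c * (U n j * cnj (U n j)) * time_average U n j) * cnj (D j) = 0"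
      using scheme n that unfolding scheme_def c_def by simp
    then have "Re (\<i> * central_diff \<tau> U n j * cnj (D j))
        + Re (discrete_laplacian L N (time_average U n) j * cnj (D j))
        + Re (of_real c * (U n j * cnj (U n j)) * time_average U n j * cnj (D j)) = 0"
      by (simp only: distrib_right plus_complex.sel[symmetric] zero_complex.sel)
    then show ?thesis
      unfolding central_diff_def time_average_def D_def
        Re_i_difference_quotient Re_average_difference by linarith
  qed
  have "((grid_seminorm L N (U (n - 1)))\<^sup>2 - (grid_seminorm L N (U (n + 1)))\<^sup>2) / 2 =
      Re (grid_inner L N (discrete_laplacian L N (time_average U n)) D)"
    unfolding time_average_def D_def Re_laplacian_average_difference[OF L] ..
  also have "\<dots> = ?h * (\<Sum>j\<in>?G. Re (discrete_laplacian L N (time_average U n) j * cnj (D j)))"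
    unfolding grid_inner_def Re_sum[symmetric] by simp
  also have "\<dots> = ?h * (- (c / 2 * (S - S')))"
    by (simp only: pointwise S_def S'_def sum_negf sum_distrib_left[symmetric] sum_subtractf
        cong: sum.cong)
  also have "\<dots> = - P / 2"
    by (simp add: P_def)
  finally show ?thesis
    unfolding S_def[symmetric] S'_def[symmetric] c_def[symmetric] P_def[symmetric] by (simp add: field_simps)
qed

lemma total_energy_step:
  assumes L: "\<forall>r\<in>{1, 2, 3}. 0 < L r" and scheme: "scheme L N \<beta> \<gamma> \<tau> M U"
    and n: "Suc n \<in> {1..M - 1}"
  shows "total_energy L N \<beta> \<gamma> \<tau> U (Suc n) = total_energy L N \<beta> \<gamma> \<tau> U n"
proof -
  have decay: "exp (- 2 * \<gamma> * (real (Suc n) * \<tau>)) =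
      exp (- 2 * \<gamma> * (real n * \<tau>)) * exp (- 2 * \<gamma> * \<tau>)"
    by (simp add: algebra_simps flip: exp_add)
  show ?thesis
    using scheme_energy_balance[OF L scheme n]
    unfolding total_energy_def decay
    by (simp add: algebra_simps)
qed

theorem theorem2p2:
  fixes L :: "nat \<Rightarrow> real" and N :: "nat \<Rightarrow> nat"
    and T \<beta> \<gamma> \<tau> :: real and M :: nat and U :: "nat \<Rightarrow> grid_fun"
  assumes "\<forall>r\<in>{1, 2, 3}. 0 < L r"
    and "\<forall>r\<in>{1, 2, 3}. 0 < N r \<and> even (N r)"
    and "0 < T" and "0 < M" and "\<tau> = T / real M"
    and "0 < \<gamma>"
    and "\<forall>n\<in>{0..M}. U n \<in> grid_space N"
    and "scheme L N \<beta> \<gamma> \<tau> M U"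
  shows "\<forall>n\<in>{1..M - 1}. total_energy L N \<beta> \<gamma> \<tau> U n = total_energy L N \<beta> \<gamma> \<tau> U 0"
proof
  fix n assume "n \<in> {1..M - 1}"
  then have "n \<le> M - 1" by simp
  then show "total_energy L N \<beta> \<gamma> \<tau> U n = total_energy L N \<beta> \<gamma> \<tau> U 0"
    by (induction n) (simp_all add: total_energy_step[OF assms(1) assms(8)])
qed

end
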